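(* Consider, for potential $V$ equal to zero, the finite-difference scheme $$ \frac{\delta_t^2u_n^k}{(\Delta t)^2}-\left(c^2+\frac{\beta}{2\Delta t}\delta_t\right)\delta_x^2u_n^k+\frac{\alpha}{2\Delta t}\delta_tu_n^k+\frac{m^2}{2}\left[u_n^{k+1}+u_n^{k-1}\right]=0 . $$ This scheme is consistent of order $\mathcal{O}(\Delta t)^2$ with the linear system $$ \frac{d^2u_n}{dt^2}-\left(c^2+\beta\frac{d}{dt}\right)\Delta_x^2u_n+\alpha\frac{du_n}{dt}+m^2u_n=0 . $$ Moreover, a necessary condition for the scheme to be stable order $n$ is that $$ \left(c^2-\frac{m^2}{4}\right)(\Delta t)^2<1+\left(\frac{\alpha}{4}+\beta\right)\Delta t . $$
   Context: Here $\alpha,\beta\ge 0$ are the external and internal damping coefficients, $c$ is the coupling coefficient ($c\gg 1$), $m^2$ is a real constant ($m$ real or pure-imaginary, with $|m|\ll 1$; in particular $1+m^2(\Delta t)^2/2>0$), and $\Delta t>0$ is the time step. Notation: $u_n^k$ approximates $u_n(k\Delta t)$; $\Delta_x^2u_n=u_{n+1}-2u_n+u_{n-1}$, $\delta_tu_n^k=u_n^{k+1}-u_n^{k-1}$, $\delta_t^2u_n^k=u_n^{k+1}-2u_n^k+u_n^{k-1}$, $\delta_x^2u_n^k=u_{n+1}^k-2u_n^k+u_{n-1}^k$. Consistency of order $\mathcal{O}(\Delta t)^2$ means: if smooth functions $u_n(t)$ satisfy the linear system, then substituting $u_n^k=u_n(k\Delta t)$ into the left-hand side of the scheme gives a residual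 that is $\mathcal{O}((\Delta t)^2)$ as $\Delta t\to 0$. Stability: writing the scheme as a two-level system for the vector $(u_n^{k+1},u_n^{k})^t$ and applying the Fourier transform in $n$ yields, for each $\xi$, the amplification matrix $$ A(\xi)=\begin{pmatrix}\dfrac{2}{\hat g(\xi)}\left(1-2c^2(\Delta t)^2\sin^2\dfrac{\xi}{2}\right)&-\dfrac{\hat h(\xi)}{\hat g(\xi)}\\[2mm]1&0\end{pmatrix}, $$ where $\hat g(\xi)=1+\alpha\frac{\Delta t}{2}+2\beta\Delta t\sin^2\frac{\xi}{2}+m^2\frac{(\Delta t)^2}{2}$ and $\hat h(\xi)=1-\alpha\frac{\Delta t}{2}-2\beta\Delta t\sin^2\frac{\xi}{2}+m^2\frac{(\Delta t)^2}{2}$. The scheme is stable order $n$ if there are constants $K_1,K_2$ such that $\|A(\xi)^n\|\le K_1+nK_2$ for all $n\in\mathbb{N}$ and all $\xi\in[-\pi,\pi]$.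
   Formalization: The strict inequality fails when α=β=0, m²≥0 and (c²−m²/4)(Δt)²=1, where the scheme is still stable order n (e.g. m=0, c=10, Δt=1/10); the formal conclusion is the strict inequality or exactly this case. *)

theory Defs
  imports "HOL-Analysis.Analysis"
begin

text \<open>
  Sequences on the lattice are indexed by \<open>int\<close>. A grid function \<open>u\<close> has \<open>u n k\<close> standing for
  $u_n^k$; the time index is an \<open>int\<close> so that \<open>k - 1\<close> is not truncated.
\<close>

definition lap :: "(int \<Rightarrow> real) \<Rightarrow> int \<Rightarrow> real" where
  "lap v n = v (n + 1) - 2 * v n + v (n - 1)"

definition \<delta>x2 :: "(int \<Rightarrow> int \<Rightarrow> real) \<Rightarrow> int \<Rightarrow> int \<Rightarrow> real" where
  "\<delta>x2 u n k = lap (\<lambda>j. u j k) n"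

definition \<delta>t :: "(int \<Rightarrow> int \<Rightarrow> real) \<Rightarrow> int \<Rightarrow> int \<Rightarrow> real" where
  "\<delta>t u n k = u n (k + 1) - u n (k - 1)"

definition \<delta>t2 :: "(int \<Rightarrow> int \<Rightarrow> real) \<Rightarrow> int \<Rightarrow> int \<Rightarrow> real" where
  "\<delta>t2 u n k = u n (k + 1) - 2 * u n k + u n (k - 1)"

text \<open>
  The parameter \<open>msq\<close> is the real number $m^2$, which is negative when $m$ is pure imaginary.
\<close>

definition scheme_lhs ::
  "real \<Rightarrow> real \<Rightarrow> real \<Rightarrow> real \<Rightarrow> real \<Rightarrow> (int \<Rightarrow> int \<Rightarrow> real) \<Rightarrow> int \<Rightarrow> int \<Rightarrow> real" where
  "scheme_lhs \<alpha> \<beta> c msq dt u n k =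
     \<delta>t2 u n k / dt\<^sup>2
     - (c\<^sup>2 * \<delta>x2 u n k + \<beta> / (2 * dt) * \<delta>t (\<delta>x2 u) n k)
     + \<alpha> / (2 * dt) * \<delta>t u n k
     + msq / 2 * (u n (k + 1) + u n (k - 1))"

text \<open>
  Derivatives are taken relative to \<open>S\<close>, hence are one-sided at the end points of an interval.
\<close>

definition nth_deriv :: "real set \<Rightarrow> nat \<Rightarrow> (real \<Rightarrow> real) \<Rightarrow> real \<Rightarrow> real" where
  "nth_deriv S j f = ((\<lambda>g t. vector_derivative g (at t within S)) ^^ j) f"

definition smooth_on :: "real set \<Rightarrow> (real \<Rightarrow> real) \<Rightarrow> bool" where
  "smooth_on S f \<longleftrightarrow> (\<forall>j. nth_deriv S j f differentiable_on S)"

definition solves_linear_system ::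
  "real \<Rightarrow> real \<Rightarrow> real \<Rightarrow> real \<Rightarrow> real set \<Rightarrow> (int \<Rightarrow> real \<Rightarrow> real) \<Rightarrow> bool" where
  "solves_linear_system \<alpha> \<beta> c msq S u \<longleftrightarrow>
     (\<forall>n. \<forall>t\<in>S.
        nth_deriv S 2 (u n) t
        - (c\<^sup>2 * lap (\<lambda>j. u j t) n + \<beta> * nth_deriv S 1 (\<lambda>s. lap (\<lambda>j. u j s) n) t)
        + \<alpha> * nth_deriv S 1 (u n) t
        + msq * u n t = 0)"

text \<open>
  The bound on the residual at site \<open>n\<close> is uniform over all time levels whose stencil lies in
  $[0,T]$. It is not uniform in \<open>n\<close>, since no bound on the solution over the infinite lattice
  is assumed.
\<close>

definition consistent_order2 :: "real \<Rightarrow> real \<Rightarrow> real \<Rightarrow> real \<Rightarrow> bool" where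
  "consistent_order2 \<alpha> \<beta> c msq \<longleftrightarrow>
     (\<forall>T>0. \<forall>u :: int \<Rightarrow> real \<Rightarrow> real.
        (\<forall>n. smooth_on {0..T} (u n)) \<and> solves_linear_system \<alpha> \<beta> c msq {0..T} u \<longrightarrow>
        (\<forall>n. \<exists>K. \<forall>\<^sub>F dt in at_right 0. \<forall>k\<ge>1. (of_int k + 1) * dt \<le> T \<longrightarrow>
           \<bar>scheme_lhs \<alpha> \<beta> c msq dt (\<lambda>j l. u j (of_int l * dt)) n k\<bar> \<le> K * dt\<^sup>2))"

definition ghat :: "real \<Rightarrow> real \<Rightarrow> real \<Rightarrow> real \<Rightarrow> real \<Rightarrow> real" where
  "ghat \<alpha> \<beta> msq dt \<xi> = 1 + \<alpha> * dt / 2 + 2 * \<beta> * dt * (sin (\<xi> / 2))\<^sup>2 + msq * dt\<^sup>2 / 2"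

definition hhat :: "real \<Rightarrow> real \<Rightarrow> real \<Rightarrow> real \<Rightarrow> real \<Rightarrow> real" where
  "hhat \<alpha> \<beta> msq dt \<xi> = 1 - \<alpha> * dt / 2 - 2 * \<beta> * dt * (sin (\<xi> / 2))\<^sup>2 + msq * dt\<^sup>2 / 2"

definition amp_matrix :: "real \<Rightarrow> real \<Rightarrow> real \<Rightarrow> real \<Rightarrow> real \<Rightarrow> real \<Rightarrow> real^2^2" where
  "amp_matrix \<alpha> \<beta> c msq dt \<xi> =
     vector [vector [2 / ghat \<alpha> \<beta> msq dt \<xi> * (1 - 2 * c\<^sup>2 * dt\<^sup>2 * (sin (\<xi> / 2))\<^sup>2),
                     - (hhat \<alpha> \<beta> msq dt \<xi> / ghat \<alpha> \<beta> msq dt \<xi>)],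
             vector [1, 0]]"

text \<open>
  The action of the scheme on a Fourier mode of frequency \<open>\<xi>\<close> and arbitrary phase; solving
  for \<open>w (k + 1)\<close> gives the two-level recursion with matrix \<open>amp_matrix\<close>.
\<close>

lemma scheme_lhs_fourier_mode:
  assumes "dt \<noteq> 0"
  shows "scheme_lhs \<alpha> \<beta> c msq dt (\<lambda>n k. w k * cos (of_int n * \<xi> + \<phi>)) n k =
    cos (of_int n * \<xi> + \<phi>) / dt\<^sup>2 *
      (ghat \<alpha> \<beta> msq dt \<xi> * w (k + 1)
       - 2 * (1 - 2 * c\<^sup>2 * dt\<^sup>2 * (sin (\<xi> / 2))\<^sup>2) * w k
       + hhat \<alpha> \<beta> msq dt \<xi> * w (k - 1))"
proof -
  define C where "C = cos (of_int n * \<xi> + \<phi>)"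
  define s where "s = (sin (\<xi> / 2))\<^sup>2"
  have "cos \<xi> = 1 - 2 * s"
    unfolding s_def using cos_double_sin[of "\<xi> / 2"] by simp
  moreover have "cos (of_int (n + 1) * \<xi> + \<phi>) + cos (of_int (n - 1) * \<xi> + \<phi>) = 2 * cos \<xi> * C"
    using cos_add[of "of_int n * \<xi> + \<phi>" \<xi>] cos_diff[of "of_int n * \<xi> + \<phi>" \<xi>]
    unfolding C_def by (simp add: algebra_simps)
  ultimately have L:
    "cos (of_int (n + 1) * \<xi> + \<phi>) = 2 * (1 - 2 * s) * C - cos (of_int (n - 1) * \<xi> + \<phi>)"
    by simp
  have X: "\<delta>x2 (\<lambda>n k. w k * cos (of_int n * \<xi> + \<phi>)) n = (\<lambda>l. - 4 * s * C * w l)"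
    unfolding \<delta>x2_def lap_def L C_def[symmetric] by (rule ext) (simp add: algebra_simps)
  show ?thesis
    unfolding scheme_lhs_def \<delta>t_def \<delta>t2_def X ghat_def hhat_def C_def[symmetric] s_def[symmetric]
    using assms by (simp add: field_simps power2_eq_square)
qed

text \<open>
  Powers are with respect to \<open>**\<close>; the operation \<open>^\<close> on \<open>real^2^2\<close> acts entrywise.
\<close>

definition matrix_power :: "real^2^2 \<Rightarrow> nat \<Rightarrow> real^2^2" where
  "matrix_power A n = ((**) A ^^ n) (mat 1)"

definition stable_order_n :: "real \<Rightarrow> real \<Rightarrow> real \<Rightarrow> real \<Rightarrow> real \<Rightarrow> bool" where
  "stable_order_n \<alpha> \<beta> c msq dt \<longleftrightarrow>
     (\<exists>K1 K2. \<forall>n. \<forall>\<xi>\<in>{-pi..pi}.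
        onorm ((*v) (matrix_power (amp_matrix \<alpha> \<beta> c msq dt \<xi>) n)) \<le> K1 + real n * K2)"

text \<open>
  Necessity of the strict inequality
  $(c^2 - m^2/4)(\Delta t)^2 < 1 + (\alpha/4 + \beta)\Delta t$ for stability order $n$ has a
  boundary exception. Without damping and with $m^2 \geq 0$, the case of equality is stable
  order $n$: the eigenvalue $-1$ at $\xi = \pi$ is double, and the powers of the amplification
  matrices grow at most linearly, uniformly in $\xi$. An example is
  $\alpha = \beta = m^2 = 0$, $c\,\Delta t = 1$.
\<close>

end

theory Submission
  imports Defs
begin

text \<open>
  Consistency. The difference quotients in time and the time average of the mass term are central,
  so in the Taylor expansions at \<open>t\<close> of \<open>f (t + h)\<close> and \<open>f (t - h)\<close> every term of the wrong parity
  cancels, and each of these expressions differs from its continuous counterpart by a quantity of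
  order \<open>h\<^sup>2\<close>. The constant comes from a bound for some higher derivative on the compact time
  interval, which makes it uniform in \<open>t\<close>. Since the Laplacian couples only three sites, the residual at a fixed site is
  a fixed linear combination of finitely many such errors.

  Stability. The matrix \<open>amp_matrix\<close> is the companion matrix of
  \<open>\<lambda>\<^sup>2 - a * \<lambda> + b\<close>, where \<open>a\<close> and \<open>- b\<close> are the entries of its first row. If this
  monic quadratic is negative at \<open>1\<close> or at \<open>-1\<close>, it has a real root of modulus greater than one;
  the root is an eigenvalue, and the powers of the matrix grow exponentially. At the highest
  frequency \<open>\<xi> = \<pi>\<close> the value of the quadratic at \<open>-1\<close> is a positive multiple of
  $1 - (c^2 - m^2/4)(\Delta t)^2$, so stability forces $(c^2 - m^2/4)(\Delta t)^2 \leq 1$.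
  This already implies the asserted strict inequality unless the damping vanishes and equality
  holds. In that remaining case, if $m^2 < 0$, the lowest frequency
  \<open>\<xi> = 0\<close> is unstable: there \<open>ghat = hhat < 1\<close>, which makes the quadratic negative at \<open>1\<close>.
\<close>

section \<open>Taylor expansion and central differences on a closed interval\<close>

lemma nth_deriv_0 [simp]: "nth_deriv S 0 f = f"
  by (simp add: nth_deriv_def)

lemma nth_deriv_Suc:
  "nth_deriv S (Suc j) f t = vector_derivative (nth_deriv S j f) (at t within S)"
  by (simp add: nth_deriv_def)

lemma smooth_on_has_field_derivative:
  assumes "smooth_on S f" and "t \<in> S"
  shows "(nth_deriv S j f has_field_derivative nth_deriv S (Suc j) f t) (at t within S)"
proof -
  have "nth_deriv S j f differentiable (at t within S)"
    using assms by (simp add: smooth_on_def differentiable_on_def)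
  then show ?thesis
    by (simp add: vector_derivative_works nth_deriv_Suc
        has_real_derivative_iff_has_vector_derivative)
qed

text \<open>
  Derivatives are relative to the interval, so the expansion is also valid at its end points, where
  they are one-sided. Compactness gives a remainder constant that serves all centres \<open>w\<close>.
\<close>

lemma smooth_on_uniform_Taylor:
  assumes f: "smooth_on {a..b} f"
  shows "\<exists>B. \<forall>w\<in>{a..b}. \<forall>z\<in>{a..b}.
      \<bar>f z - (\<Sum>i\<le>n. nth_deriv {a..b} i f w * (z - w) ^ i / fact i)\<bar> \<le> B * \<bar>z - w\<bar> ^ Suc n"
proof -
  have "continuous_on {a..b} (nth_deriv {a..b} (Suc n) f)"
    using f by (simp add: smooth_on_def differentiable_imp_continuous_on)
  then have "bounded (nth_deriv {a..b} (Suc n) f ` {a..b})"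
    by (intro compact_imp_bounded compact_continuous_image) auto
  then obtain C where C: "\<And>x. x \<in> {a..b} \<Longrightarrow> norm (nth_deriv {a..b} (Suc n) f x) \<le> C"
    unfolding bounded_iff by blast
  have "\<bar>f z - (\<Sum>i\<le>n. nth_deriv {a..b} i f w * (z - w) ^ i / fact i)\<bar>
      \<le> C / fact n * \<bar>z - w\<bar> ^ Suc n" if "w \<in> {a..b}" "z \<in> {a..b}" for w z
  proof -
    have "norm (nth_deriv {a..b} 0 f z - (\<Sum>i\<le>n. nth_deriv {a..b} i f w * (z - w) ^ i / fact i))
        \<le> C * norm (z - w) ^ Suc n / fact n"
      using that by (intro field_Taylor[of "{a..b}"] smooth_on_has_field_derivative f C) auto
    then show ?thesis
      by simp
  qed
  then show ?thesis
    by blast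
qed

text \<open>
  In each of the three central expressions below, the term of the Taylor polynomial that would
  limit the accuracy to first order in \<open>h\<close> has opposite contributions from \<open>t + h\<close> and \<open>t - h\<close>
  and drops out. Hence the degree of the expansion is one more than the order of the derivative
  that is approximated.
\<close>

lemma central_mean_error:
  assumes "smooth_on {a..b} f"
  obtains K where "\<And>t h. \<lbrakk>0 < h; a \<le> t - h; t + h \<le> b\<rbrakk> \<Longrightarrow>
    \<bar>(f (t + h) + f (t - h)) / 2 - f t\<bar> \<le> K * h\<^sup>2"
proof -
  obtain B where B: "\<And>w z. \<lbrakk>w \<in> {a..b}; z \<in> {a..b}\<rbrakk> \<Longrightarrow>
      \<bar>f z - (\<Sum>i\<le>1. nth_deriv {a..b} i f w * (z - w) ^ i / fact i)\<bar> \<le> B * \<bar>z - w\<bar> ^ Suc 1"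
    using smooth_on_uniform_Taylor[OF assms, of 1] by blast
  have "\<bar>(f (t + h) + f (t - h)) / 2 - f t\<bar> \<le> B * h\<^sup>2"
    if "0 < h" "a \<le> t - h" "t + h \<le> b" for t h
    using B[of t "t + h"] B[of t "t - h"] that
    by (simp add: power2_eq_square abs_le_iff field_simps)
  then show thesis
    by (rule that)
qed

lemma central_first_difference_error:
  assumes "smooth_on {a..b} f"
  obtains K where "\<And>t h. \<lbrakk>0 < h; a \<le> t - h; t + h \<le> b\<rbrakk> \<Longrightarrow>
    \<bar>(f (t + h) - f (t - h)) / (2 * h) - nth_deriv {a..b} 1 f t\<bar> \<le> K * h\<^sup>2"
proof -
  obtain B where B: "\<And>w z. \<lbrakk>w \<in> {a..b}; z \<in> {a..b}\<rbrakk> \<Longrightarrow>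
      \<bar>f z - (\<Sum>i\<le>2. nth_deriv {a..b} i f w * (z - w) ^ i / fact i)\<bar> \<le> B * \<bar>z - w\<bar> ^ Suc 2"
    using smooth_on_uniform_Taylor[OF assms, of 2] by blast
  have "\<bar>(f (t + h) - f (t - h)) / (2 * h) - nth_deriv {a..b} 1 f t\<bar> \<le> B * h\<^sup>2"
    if h: "0 < h" "a \<le> t - h" "t + h \<le> b" for t h
  proof -
    have "\<bar>f (t + h) - f (t - h) - 2 * h * nth_deriv {a..b} 1 f t\<bar> \<le> 2 * B * h ^ 3"
      using B[of t "t + h"] B[of t "t - h"] h
      by (simp add: eval_nat_numeral abs_le_iff field_simps)
    moreover have "(f (t + h) - f (t - h)) / (2 * h) - nth_deriv {a..b} 1 f t
        = (f (t + h) - f (t - h) - 2 * h * nth_deriv {a..b} 1 f t) / (2 * h)"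
      using h by (simp add: field_simps)
    ultimately show ?thesis
      using h by (simp add: divide_le_eq eval_nat_numeral algebra_simps)
  qed
  then show thesis
    by (rule that)
qed

lemma central_second_difference_error:
  assumes "smooth_on {a..b} f"
  obtains K where "\<And>t h. \<lbrakk>0 < h; a \<le> t - h; t + h \<le> b\<rbrakk> \<Longrightarrow>
    \<bar>(f (t + h) - 2 * f t + f (t - h)) / h\<^sup>2 - nth_deriv {a..b} 2 f t\<bar> \<le> K * h\<^sup>2"
proof -
  obtain B where B: "\<And>w z. \<lbrakk>w \<in> {a..b}; z \<in> {a..b}\<rbrakk> \<Longrightarrow>
      \<bar>f z - (\<Sum>i\<le>3. nth_deriv {a..b} i f w * (z - w) ^ i / fact i)\<bar> \<le> B * \<bar>z - w\<bar> ^ Suc 3"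
    using smooth_on_uniform_Taylor[OF assms, of 3] by blast
  have "\<bar>(f (t + h) - 2 * f t + f (t - h)) / h\<^sup>2 - nth_deriv {a..b} 2 f t\<bar> \<le> (2 * B) * h\<^sup>2"
    if h: "0 < h" "a \<le> t - h" "t + h \<le> b" for t h
  proof -
    have "\<bar>f (t + h) - 2 * f t + f (t - h) - h\<^sup>2 * nth_deriv {a..b} 2 f t\<bar> \<le> 2 * B * h ^ 4"
      using B[of t "t + h"] B[of t "t - h"] h
      by (simp add: eval_nat_numeral abs_le_iff field_simps)
    moreover have "(f (t + h) - 2 * f t + f (t - h)) / h\<^sup>2 - nth_deriv {a..b} 2 f t
        = (f (t + h) - 2 * f t + f (t - h) - h\<^sup>2 * nth_deriv {a..b} 2 f t) / h\<^sup>2"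
      using h by (simp add: field_simps)
    ultimately show ?thesis
      using h by (simp add: divide_le_eq eval_nat_numeral algebra_simps)
  qed
  then show thesis
    by (rule that)
qed

section \<open>Consistency\<close>

text \<open>
  A nondegenerate interval is needed because otherwise the derivative relative to it is not
  unique.
\<close>

lemma nth_deriv_1_lap:
  assumes "a < b" and t: "t \<in> {a..b}" and u: "\<And>n. smooth_on {a..b} (u n)"
  shows "nth_deriv {a..b} 1 (\<lambda>s. lap (\<lambda>j. u j s) n) t = lap (\<lambda>j. nth_deriv {a..b} 1 (u j) t) n"
proof -
  have "(u j has_field_derivative nth_deriv {a..b} 1 (u j) t) (at t within {a..b})" for j
    using smooth_on_has_field_derivative[OF u t, where j = 0] by simp
  then have "((\<lambda>s. lap (\<lambda>j. u j s) n) has_field_derivative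
      lap (\<lambda>j. nth_deriv {a..b} 1 (u j) t) n) (at t within {a..b})"
    unfolding lap_def by (intro derivative_intros DERIV_cmult) auto
  then show ?thesis
    using vector_derivative_within_closed_interval[OF assms(1,2)]
    by (simp add: nth_deriv_Suc has_real_derivative_iff_has_vector_derivative)
qed

lemma scheme_residual_bound:
  assumes "0 < T" and u: "\<And>n. smooth_on {0..T} (u n)"
    and sol: "solves_linear_system \<alpha> \<beta> c msq {0..T} u"
  obtains K where "\<And>dt k. \<lbrakk>0 < dt; 1 \<le> k; (of_int k + 1) * dt \<le> T\<rbrakk> \<Longrightarrow>
    \<bar>scheme_lhs \<alpha> \<beta> c msq dt (\<lambda>j l. u j (of_int l * dt)) n k\<bar> \<le> K * dt\<^sup>2"
proof -
  define D1 where "D1 j t h = (u j (t + h) - u j (t - h)) / (2 * h) - nth_deriv {0..T} 1 (u j) t"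
    for j t h
  define D2 where "D2 t h =
      (u n (t + h) - 2 * u n t + u n (t - h)) / h\<^sup>2 - nth_deriv {0..T} 2 (u n) t" for t h
  define D0 where "D0 t h = (u n (t + h) + u n (t - h)) / 2 - u n t" for t h
  have "\<exists>K. \<forall>t h. 0 < h \<and> 0 \<le> t - h \<and> t + h \<le> T \<longrightarrow> \<bar>D1 j t h\<bar> \<le> K * h\<^sup>2" for j
    using central_first_difference_error[OF u, of j] unfolding D1_def by metis
  then obtain K1 where K1: "\<And>j t h. \<lbrakk>0 < h; 0 \<le> t - h; t + h \<le> T\<rbrakk> \<Longrightarrow> \<bar>D1 j t h\<bar> \<le> K1 j * h\<^sup>2"
    by metis
  obtain K2 where K2: "\<And>t h. \<lbrakk>0 < h; 0 \<le> t - h; t + h \<le> T\<rbrakk> \<Longrightarrow> \<bar>D2 t h\<bar> \<le> K2 * h\<^sup>2"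
    using central_second_difference_error[OF u, of n] unfolding D2_def by metis
  obtain K0 where K0: "\<And>t h. \<lbrakk>0 < h; 0 \<le> t - h; t + h \<le> T\<rbrakk> \<Longrightarrow> \<bar>D0 t h\<bar> \<le> K0 * h\<^sup>2"
    using central_mean_error[OF u, of n] unfolding D0_def by metis
  define K where "K = K2 + \<bar>\<beta>\<bar> * (K1 (n + 1) + 2 * K1 n + K1 (n - 1)) + \<bar>\<alpha>\<bar> * K1 n + \<bar>msq\<bar> * K0"
  have "\<bar>scheme_lhs \<alpha> \<beta> c msq dt (\<lambda>j l. u j (of_int l * dt)) n k\<bar> \<le> K * dt\<^sup>2"
    if dt: "0 < dt" "1 \<le> k" "(of_int k + 1) * dt \<le> T" for dt k
  proof -
    define t where "t = of_int k * dt"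
    have "dt \<le> t"
      using dt mult_right_mono[of 1 "of_int k" dt] by (simp add: t_def)
    then have t: "0 \<le> t - dt" "t + dt \<le> T" "t \<in> {0..T}"
      using dt by (auto simp: t_def algebra_simps)
    have neighbours: "of_int (k + 1) * dt = t + dt" "of_int (k - 1) * dt = t - dt"
      by (simp_all add: t_def algebra_simps)
    have "nth_deriv {0..T} 2 (u n) t
        - (c\<^sup>2 * lap (\<lambda>j. u j t) n + \<beta> * lap (\<lambda>j. nth_deriv {0..T} 1 (u j) t) n)
        + \<alpha> * nth_deriv {0..T} 1 (u n) t + msq * u n t = 0"
      using sol[unfolded solves_linear_system_def, rule_format, OF t(3), of n]
      by (simp only: nth_deriv_1_lap[OF \<open>0 < T\<close> t(3) u])
    then have ode: "nth_deriv {0..T} 2 (u n) t = c\<^sup>2 * lap (\<lambda>j. u j t) n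
        + \<beta> * lap (\<lambda>j. nth_deriv {0..T} 1 (u j) t) n - \<alpha> * nth_deriv {0..T} 1 (u n) t - msq * u n t"
      by linarith
    let ?v = "\<lambda>j l. u j (of_int l * dt)"
    have second: "\<delta>t2 ?v n k / dt\<^sup>2 = nth_deriv {0..T} 2 (u n) t + D2 t dt"
      unfolding \<delta>t2_def D2_def neighbours t_def[symmetric] by simp
    have first: "\<delta>t ?v j k = 2 * dt * (nth_deriv {0..T} 1 (u j) t + D1 j t dt)" for j
      using dt(1) unfolding \<delta>t_def D1_def neighbours by simp
    have mean: "?v n (k + 1) + ?v n (k - 1) = 2 * (u n t + D0 t dt)"
      unfolding neighbours D0_def by simp
    have cancel: "x / (2 * dt) * (2 * dt * y) = x * y" for x y
      using dt(1) by simp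
    have "\<delta>t (\<delta>x2 ?v) n k = lap (\<lambda>j. \<delta>t ?v j k) n"
      by (simp add: \<delta>t_def \<delta>x2_def lap_def)
    also have "\<dots> = 2 * dt * (lap (\<lambda>j. nth_deriv {0..T} 1 (u j) t) n + lap (\<lambda>j. D1 j t dt) n)"
      unfolding first lap_def by (simp only: algebra_simps)
    finally have mixed: "\<beta> / (2 * dt) * \<delta>t (\<delta>x2 ?v) n k
        = \<beta> * (lap (\<lambda>j. nth_deriv {0..T} 1 (u j) t) n + lap (\<lambda>j. D1 j t dt) n)"
      by (simp only: cancel)
    have lap_error: "\<bar>D1 (n + 1) t dt - 2 * D1 n t dt + D1 (n - 1) t dt\<bar>
        \<le> K1 (n + 1) * dt\<^sup>2 + 2 * (K1 n * dt\<^sup>2) + K1 (n - 1) * dt\<^sup>2"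
      using K1[OF dt(1) t(1,2), of "n + 1"] K1[OF dt(1) t(1,2), of n]
        K1[OF dt(1) t(1,2), of "n - 1"] by linarith
    have triangle: "\<bar>x - y + z + w\<bar> \<le> \<bar>x\<bar> + \<bar>y\<bar> + \<bar>z\<bar> + \<bar>w\<bar>" for x y z w :: real
      by linarith
    have space: "\<delta>x2 ?v n k = lap (\<lambda>j. u j t) n"
      by (simp add: \<delta>x2_def t_def)
    \<comment> \<open>Eliminating the second derivative by the differential equation cancels every exact term.\<close>
    have "scheme_lhs \<alpha> \<beta> c msq dt ?v n k
        = D2 t dt - \<beta> * lap (\<lambda>j. D1 j t dt) n + \<alpha> * D1 n t dt + msq * D0 t dt"
      unfolding scheme_lhs_def second space mixed first mean cancel ode
      by (simp add: algebra_simps)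
    also have "\<dots> = D2 t dt - \<beta> * (D1 (n + 1) t dt - 2 * D1 n t dt + D1 (n - 1) t dt)
          + \<alpha> * D1 n t dt + msq * D0 t dt"
      by (simp add: lap_def)
    also have "\<bar>\<dots>\<bar> \<le> \<bar>D2 t dt\<bar> + \<bar>\<beta> * (D1 (n + 1) t dt - 2 * D1 n t dt + D1 (n - 1) t dt)\<bar>
        + \<bar>\<alpha> * D1 n t dt\<bar> + \<bar>msq * D0 t dt\<bar>"
      by (rule triangle)
    also have "\<dots> \<le> K2 * dt\<^sup>2
        + \<bar>\<beta>\<bar> * (K1 (n + 1) * dt\<^sup>2 + 2 * (K1 n * dt\<^sup>2) + K1 (n - 1) * dt\<^sup>2)
        + \<bar>\<alpha>\<bar> * (K1 n * dt\<^sup>2) + \<bar>msq\<bar> * (K0 * dt\<^sup>2)"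
      unfolding abs_mult using dt(1) t(1,2)
      by (intro add_mono mult_left_mono K0 K1 K2 lap_error) auto
    also have "\<dots> = K * dt\<^sup>2"
      by (simp add: K_def algebra_simps)
    finally show ?thesis .
  qed
  then show thesis
    by (rule that)
qed

lemma scheme_consistent_order2: "consistent_order2 \<alpha> \<beta> c msq"
  unfolding consistent_order2_def
proof (intro allI impI, elim conjE)
  fix T :: real and u :: "int \<Rightarrow> real \<Rightarrow> real" and n :: int
  assume "0 < T" "\<forall>n. smooth_on {0..T} (u n)" "solves_linear_system \<alpha> \<beta> c msq {0..T} u"
  then obtain K where "\<And>dt k. \<lbrakk>0 < dt; 1 \<le> k; (of_int k + 1) * dt \<le> T\<rbrakk> \<Longrightarrow>
      \<bar>scheme_lhs \<alpha> \<beta> c msq dt (\<lambda>j l. u j (of_int l * dt)) n k\<bar> \<le> K * dt\<^sup>2"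
    using scheme_residual_bound[of T u \<alpha> \<beta> c msq n] by metis
  then show "\<exists>K. \<forall>\<^sub>F dt in at_right 0. \<forall>k\<ge>1. (of_int k + 1) * dt \<le> T \<longrightarrow>
      \<bar>scheme_lhs \<alpha> \<beta> c msq dt (\<lambda>j l. u j (of_int l * dt)) n k\<bar> \<le> K * dt\<^sup>2"
    using eventually_at_right_less[of "0::real"] by (intro exI[of _ K]) (auto elim: eventually_mono)
qed

section \<open>Exponential growth of powers of companion matrices\<close>

lemma matrix_power_eigenvector:
  assumes "A *v x = r *\<^sub>R x"
  shows "matrix_power A n *v x = r ^ n *\<^sub>R x"
proof (induction n)
  case 0
  show ?case
    by (simp add: matrix_power_def)
next
  case (Suc n)
  have "matrix_power A (Suc n) *v x = A *v (matrix_power A n *v x)"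
    by (simp add: matrix_power_def matrix_vector_mul_assoc)
  then show ?case
    by (simp add: Suc assms matrix_vector_mult_scaleR)
qed

lemma eigenvalue_power_le_onorm_matrix_power:
  assumes "A *v x = r *\<^sub>R x" and "x \<noteq> 0"
  shows "\<bar>r\<bar> ^ n \<le> onorm ((*v) (matrix_power A n))"
proof -
  have "norm (r ^ n *\<^sub>R x) \<le> onorm ((*v) (matrix_power A n)) * norm x"
    using onorm[OF matrix_vector_mul_bounded_linear, of "matrix_power A n" x]
    by (simp add: matrix_power_eigenvector[OF assms(1)])
  then show ?thesis
    using assms(2) by (simp add: power_abs)
qed

lemma companion_matrix_eigenvector:
  fixes a b r :: real
  assumes "r\<^sup>2 - a * r + b = 0"
  shows "(vector [vector [a, - b], vector [1, 0]] :: real^2^2) *v vector [r, 1]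
    = r *\<^sub>R vector [r, 1]"
  using assms
  by (simp add: vec_eq_iff forall_2 matrix_vector_mult_def sum_2 vector_2 power2_eq_square)

lemma power_not_linearly_bounded:
  fixes r :: real
  assumes "1 < r"
  shows "\<exists>n. K1 + real n * K2 < r ^ n"
proof -
  define q where "q = 1 / r"
  have q: "0 < q" "q < 1"
    using assms by (auto simp: q_def)
  have "(\<lambda>n. K1 * q ^ n + K2 * (real n * q ^ n)) \<longlonglongrightarrow> K1 * 0 + K2 * 0"
    using q powser_times_n_limit_0[of q]
    by (intro tendsto_intros LIMSEQ_realpow_zero) auto
  then have "\<forall>\<^sub>F n in sequentially. K1 * q ^ n + K2 * (real n * q ^ n) < 1"
    by (intro order_tendstoD(2)) auto
  then obtain n where "K1 * q ^ n + K2 * (real n * q ^ n) < 1"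
    using eventually_happens by fastforce
  then have "K1 + real n * K2 < r ^ n"
    using assms by (simp add: q_def power_divide divide_simps mult.commute split: if_splits)
  then show ?thesis ..
qed

text \<open>
  An upward parabola that is negative at \<open>1\<close> has a root to the right of \<open>1\<close>, and the larger root
  is given by the quadratic formula. The case of \<open>-1\<close> is its mirror image.
\<close>

lemma monic_quadratic_root_gt_1:
  fixes a b :: real
  assumes "1 - a + b < 0"
  obtains r where "1 < r" and "r\<^sup>2 - a * r + b = 0"
proof
  define d where "d = a\<^sup>2 - 4 * b"
  have gt: "(2 - a)\<^sup>2 < d"
    using assms by (simp add: d_def power2_eq_square algebra_simps)
  then have "0 \<le> d"
    using zero_le_power2[of "2 - a"] by linarith
  have "2 - a < sqrt d"
    using gt by (rule real_less_rsqrt)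
  then show "1 < (a + sqrt d) / 2"
    by simp
  show "((a + sqrt d) / 2)\<^sup>2 - a * ((a + sqrt d) / 2) + b = 0"
    using real_sqrt_pow2[OF \<open>0 \<le> d\<close>] unfolding d_def
    by (simp add: power2_eq_square field_simps)
qed

lemma monic_quadratic_root_outside_unit_interval:
  fixes a b :: real
  assumes "1 - a + b < 0 \<or> 1 + a + b < 0"
  obtains r where "1 < \<bar>r\<bar>" and "r\<^sup>2 - a * r + b = 0"
  using assms
proof
  assume "1 - a + b < 0"
  then show thesis
    using monic_quadratic_root_gt_1[of a b] that by fastforce
next
  assume "1 + a + b < 0"
  then obtain r where "1 < r" "r\<^sup>2 - (- a) * r + b = 0"
    using monic_quadratic_root_gt_1[of "- a" b] by auto
  then show thesis
    using that[of "- r"] by simp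
qed

section \<open>Necessary conditions for stability\<close>

text \<open>
  The bound on the absolute value says that the characteristic polynomial of the amplification
  matrix, multiplied by \<open>ghat\<close>, is nonnegative both at \<open>1\<close> and at \<open>-1\<close>. Otherwise an eigenvalue
  lies outside the unit disc, and linear growth is exceeded.
\<close>

lemma stable_order_n_imp_characteristic_polynomial_nonneg:
  assumes stable: "stable_order_n \<alpha> \<beta> c msq dt" and \<xi>: "\<xi> \<in> {-pi..pi}"
    and g: "0 < ghat \<alpha> \<beta> msq dt \<xi>"
  shows "\<bar>2 * (1 - 2 * c\<^sup>2 * dt\<^sup>2 * (sin (\<xi> / 2))\<^sup>2)\<bar> \<le> ghat \<alpha> \<beta> msq dt \<xi> + hhat \<alpha> \<beta> msq dt \<xi>"
proof (rule ccontr)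
  let ?A = "amp_matrix \<alpha> \<beta> c msq dt \<xi>"
  let ?g = "ghat \<alpha> \<beta> msq dt \<xi>"
  define a where "a = 2 / ?g * (1 - 2 * c\<^sup>2 * dt\<^sup>2 * (sin (\<xi> / 2))\<^sup>2)"
  define b where "b = hhat \<alpha> \<beta> msq dt \<xi> / ?g"
  have ag: "a * ?g = 2 * (1 - 2 * c\<^sup>2 * dt\<^sup>2 * (sin (\<xi> / 2))\<^sup>2)" and bg: "b * ?g = hhat \<alpha> \<beta> msq dt \<xi>"
    using g by (simp_all add: a_def b_def)
  assume "\<not> ?thesis"
  then have "?g + b * ?g < \<bar>a * ?g\<bar>"
    by (simp only: ag bg not_le)
  then have "(1 + b) * ?g < \<bar>a\<bar> * ?g"
    using g by (simp add: abs_mult algebra_simps)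
  then have "1 + b < \<bar>a\<bar>"
    using g by simp
  then have "1 - a + b < 0 \<or> 1 + a + b < 0"
    by linarith
  then obtain r where r: "1 < \<bar>r\<bar>" "r\<^sup>2 - a * r + b = 0"
    by (rule monic_quadratic_root_outside_unit_interval)
  have "?A *v vector [r, 1] = r *\<^sub>R vector [r, 1]"
    using companion_matrix_eigenvector[OF r(2)] by (simp add: amp_matrix_def a_def b_def)
  moreover have "(vector [r, 1] :: real^2) \<noteq> 0"
    by (simp add: vec_eq_iff forall_2 vector_2)
  ultimately have growth: "\<bar>r\<bar> ^ n \<le> onorm ((*v) (matrix_power ?A n))" for n
    by (rule eigenvalue_power_le_onorm_matrix_power)
  obtain K1 K2 where "\<And>n. onorm ((*v) (matrix_power ?A n)) \<le> K1 + real n * K2"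
    using stable \<xi> unfolding stable_order_n_def by blast
  with growth have "\<bar>r\<bar> ^ n \<le> K1 + real n * K2" for n
    using order_trans by blast
  then show False
    using power_not_linearly_bounded[OF r(1), of K1 K2] by (meson not_le)
qed

lemma stable_order_n_imp_highest_frequency_bound:
  assumes "0 \<le> \<alpha>" "0 \<le> \<beta>" "0 < dt" "0 < 1 + msq * dt\<^sup>2 / 2" "stable_order_n \<alpha> \<beta> c msq dt"
  shows "(c\<^sup>2 - msq / 4) * dt\<^sup>2 \<le> 1"
proof -
  have "0 \<le> \<alpha> * dt / 2 + 2 * \<beta> * dt"
    using assms(1-3) by simp
  then have "0 < ghat \<alpha> \<beta> msq dt pi"
    using assms(4) by (simp add: ghat_def)
  then have "\<bar>2 * (1 - 2 * c\<^sup>2 * dt\<^sup>2 * (sin (pi / 2))\<^sup>2)\<bar> \<le> ghat \<alpha> \<beta> msq dt pi + hhat \<alpha> \<beta> msq dt pi"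
    by (intro stable_order_n_imp_characteristic_polynomial_nonneg assms(5)) auto
  then show ?thesis
    by (simp add: ghat_def hhat_def algebra_simps abs_le_iff)
qed

lemma undamped_stable_order_n_imp_msq_nonneg:
  assumes "0 < dt" "0 < 1 + msq * dt\<^sup>2 / 2" "stable_order_n 0 0 c msq dt"
  shows "0 \<le> msq"
proof -
  have "\<bar>2 * (1 - 2 * c\<^sup>2 * dt\<^sup>2 * (sin (0 / 2))\<^sup>2)\<bar> \<le> ghat 0 0 msq dt 0 + hhat 0 0 msq dt 0"
    using assms by (intro stable_order_n_imp_characteristic_polynomial_nonneg) (auto simp: ghat_def)
  then have "0 \<le> msq * dt\<^sup>2"
    by (simp add: ghat_def hhat_def)
  then show ?thesis
    using assms(1) by (simp add: zero_le_mult_iff)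
qed

theorem proposition4:
  fixes \<alpha> \<beta> c msq :: real
  assumes "0 \<le> \<alpha>" and "0 \<le> \<beta>"
  shows "consistent_order2 \<alpha> \<beta> c msq \<and>
    (\<forall>dt. 0 < dt \<and> 0 < 1 + msq * dt\<^sup>2 / 2 \<and> stable_order_n \<alpha> \<beta> c msq dt \<longrightarrow>
       (c\<^sup>2 - msq / 4) * dt\<^sup>2 < 1 + (\<alpha> / 4 + \<beta>) * dt \<or>
       \<alpha> = 0 \<and> \<beta> = 0 \<and> 0 \<le> msq \<and> (c\<^sup>2 - msq / 4) * dt\<^sup>2 = 1)"
proof (intro conjI allI impI scheme_consistent_order2, elim conjE)
  fix dt :: real
  assume dt: "0 < dt" "0 < 1 + msq * dt\<^sup>2 / 2" and stable: "stable_order_n \<alpha> \<beta> c msq dt"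
  have le: "(c\<^sup>2 - msq / 4) * dt\<^sup>2 \<le> 1"
    using stable_order_n_imp_highest_frequency_bound[OF assms dt stable] .
  show "(c\<^sup>2 - msq / 4) * dt\<^sup>2 < 1 + (\<alpha> / 4 + \<beta>) * dt \<or>
      \<alpha> = 0 \<and> \<beta> = 0 \<and> 0 \<le> msq \<and> (c\<^sup>2 - msq / 4) * dt\<^sup>2 = 1"
  proof (cases "\<alpha> = 0 \<and> \<beta> = 0")
    case True
    then have "0 \<le> msq"
      using undamped_stable_order_n_imp_msq_nonneg dt stable by blast
    then show ?thesis
      using True le by auto
  next
    case False
    then have "0 < \<alpha> / 4 + \<beta>"
      using assms by auto
    then have "0 < (\<alpha> / 4 + \<beta>) * dt"
      using dt(1) by simp
    then show ?thesis
      using le by linarith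
  qed
qed

end
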